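(* Let $\mathfrak{A}$ be a unital $C^*$-algebra and let $x,y\in\mathfrak{A}$. If $x\parallel_v y$, then there exists $\theta_0\in\mathbb{R}$ such that the following statements hold. (i) $\displaystyle \sup_{\theta\in\mathbb{R}}\big\|\operatorname{Re}(e^{i\theta}x)\operatorname{Re}(e^{i(\theta+\theta_0)}y)\big\| = \sup_{\theta\in\mathbb{R}}\|\operatorname{Re}(e^{i\theta}x)\|\|\operatorname{Re}(e^{i\theta}y)\|$. (ii) $\displaystyle \sup_{\theta\in\mathbb{R}}\big\|\operatorname{Im}(e^{i\theta}x)\operatorname{Im}(e^{i(\theta+\theta_0)}y)\big\| = \sup_{\theta\in\mathbb{R}}\|\operatorname{Im}(e^{i\theta}x)\|\|\operatorname{Im}(e^{i\theta}y)\|$.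
   Context: $\mathfrak{A}$ is a complex $C^*$-algebra with unit $e$. For $x\in\mathfrak{A}$, $\operatorname{Re}(x)=\frac12(x+x^* )$ and $\operatorname{Im}(x)=\frac{1}{2i}(x-x^* )$. The set of normalized states is $\mathcal{S}(\mathfrak{A})=\{\varphi\in\mathfrak{A}':\varphi(e)=\|\varphi\|=1\}$, where $\mathfrak{A}'$ is the dual space of $\mathfrak{A}$. The numerical radius of $x$ is $v(x)=\sup\{|\varphi(x)|:\varphi\in\mathcal{S}(\mathfrak{A})\}$. An element $x\in\mathfrak{A}$ is numerical radius parallel to $y\in\mathfrak{A}$, written $x\parallel_v y$, if $v(x+\lambda y)=v(x)+v(y)$ for some $\lambda\in\mathbb{C}$ with $|\lambda|=1$. *)

theory Defs
  imports "HOL-Analysis.Analysis"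
begin

text \<open>
  Complex unital C*-algebras. The distribution has no complex normed spaces, so the complex
  scalar multiplication is added on top of the real Banach algebra classes and tied to the real
  one by \<open>scaleR_scaleC\<close>. The class \<open>real_normed_algebra_1\<close> supplies \<open>0 \<noteq> 1\<close> and
  \<open>norm 1 = 1\<close>; the latter is automatic for a nonzero C*-algebra.
\<close>

class unital_cstar_algebra = real_normed_algebra_1 + banach +
  fixes scaleC :: "complex \<Rightarrow> 'a \<Rightarrow> 'a" (infixr "*\<^sub>C" 75)
    and star :: "'a \<Rightarrow> 'a"
  assumes scaleC_add_right: "a *\<^sub>C (x + y) = a *\<^sub>C x + a *\<^sub>C y"
    and scaleC_add_left: "(a + b) *\<^sub>C x = a *\<^sub>C x + b *\<^sub>C x"
    and scaleC_scaleC: "a *\<^sub>C b *\<^sub>C x = (a * b) *\<^sub>C x"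
    and scaleC_one: "1 *\<^sub>C x = x"
    and scaleR_scaleC: "r *\<^sub>R x = complex_of_real r *\<^sub>C x"
    and mult_scaleC_left: "(a *\<^sub>C x) * y = a *\<^sub>C (x * y)"
    and mult_scaleC_right: "x * (a *\<^sub>C y) = a *\<^sub>C (x * y)"
    and norm_scaleC: "norm (a *\<^sub>C x) = cmod a * norm x"
    and star_add: "star (x + y) = star x + star y"
    and star_scaleC: "star (a *\<^sub>C x) = cnj a *\<^sub>C star x"
    and star_mult: "star (x * y) = star y * star x"
    and star_star: "star (star x) = x"
    and cstar_identity: "norm (star x * x) = (norm x)\<^sup>2"

instantiation complex :: unital_cstar_algebra
begin

definition scaleC_complex :: "complex \<Rightarrow> complex \<Rightarrow> complex"
  where "scaleC_complex a x = a * x"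

definition star_complex :: "complex \<Rightarrow> complex"
  where "star_complex = cnj"

instance
  by standard
    (simp_all add: scaleC_complex_def star_complex_def algebra_simps norm_mult
      scaleR_conv_of_real power2_eq_square)

end

definition re_part :: "'a::unital_cstar_algebra \<Rightarrow> 'a"
  where "re_part x = (1 / 2) *\<^sub>C (x + star x)"

definition im_part :: "'a::unital_cstar_algebra \<Rightarrow> 'a"
  where "im_part x = (1 / (2 * \<i>)) *\<^sub>C (x - star x)"

text \<open>
  The dual space consists of the bounded complex-linear functionals; \<open>bounded_linear\<close> alone
  is only real-linearity. The dual norm is \<open>onorm\<close>.
\<close>

definition dual_space :: "('a::unital_cstar_algebra \<Rightarrow> complex) set"
  where "dual_space = {\<phi>. bounded_linear \<phi> \<and> (\<forall>c x. \<phi> (c *\<^sub>C x) = c * \<phi> x)}"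

definition states :: "('a::unital_cstar_algebra \<Rightarrow> complex) set"
  where "states = {\<phi> \<in> dual_space. \<phi> 1 = 1 \<and> onorm \<phi> = 1}"

definition numerical_radius :: "'a::unital_cstar_algebra \<Rightarrow> real"
  where "numerical_radius x = (SUP \<phi>\<in>states. cmod (\<phi> x))"

definition numerical_radius_parallel ::
    "'a::unital_cstar_algebra \<Rightarrow> 'a \<Rightarrow> bool" (infix "\<parallel>\<^sub>v" 50)
  where "x \<parallel>\<^sub>v y \<longleftrightarrow> (\<exists>c::complex. cmod c = 1 \<and>
    numerical_radius (x + c *\<^sub>C y) = numerical_radius x + numerical_radius y)"

end

theory Submission imports Defs begin

text \<open>
  Write \<open>L(s)\<close> for the supremum over \<open>\<theta>\<close> of the norm of \<open>Re(exp(i \<theta>) x) Re(exp(i (\<theta> + s)) y)\<close> and \<open>R\<close> for the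
  right-hand side of (i). Submultiplicativity gives \<open>L(0) \<le> R\<close>, and \<open>R \<le> v(x) v(y)\<close> because every
  self-adjoint element is normed by a state. If \<open>v(x + exp(i t) y) = v(x) + v(y)\<close>, then suitable
  self-adjoint \<open>a = Re(exp(i \<theta>) x)\<close> and \<open>b = Re(exp(i (\<theta> + t)) y)\<close> make the norm of \<open>a + b\<close> as close as desired to
  \<open>v(x) + v(y)\<close>, and expanding \<open>(a + b)\<^sup>2\<close> yields \<open>L(t) \<ge> v(x) v(y)\<close>. As \<open>L\<close> is continuous, it takes the
  value \<open>R\<close> between \<open>0\<close> and \<open>t\<close>. The number \<open>exp(i t)\<close> itself need not work: for \<open>x = 1\<close>, \<open>y = i\<close> in the
  complex numbers \<open>t = - \<pi> / 2\<close> gives \<open>L(t) = 1\<close> but \<open>R = 1 / 2\<close>. Part (ii) is (i) with \<open>\<theta>\<close> shifted by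
  \<open>\<pi> / 2\<close>, since \<open>Im z = Re(- i z)\<close>.
\<close>

subsection \<open>Norming functionals\<close>

definition sublinear :: "('v::real_vector \<Rightarrow> real) \<Rightarrow> bool"
  where "sublinear p \<longleftrightarrow> (\<forall>x y. p (x + y) \<le> p x + p y) \<and> (\<forall>r x. 0 \<le> r \<longrightarrow> p (r *\<^sub>R x) = r * p x)"

lemma sublinear_add: "sublinear p \<Longrightarrow> p (x + y) \<le> p x + p y"
  and sublinear_scaleR: "sublinear p \<Longrightarrow> 0 \<le> r \<Longrightarrow> p (r *\<^sub>R x) = r * p x"
  by (auto simp: sublinear_def)

lemma sublinear_zero: "sublinear p \<Longrightarrow> p 0 = 0"
  using sublinear_scaleR[of p 0 0] by simp

lemma sublinear_minus: "sublinear p \<Longrightarrow> - p (- x) \<le> p x"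
  using sublinear_add[of p x "- x"] sublinear_zero[of p] by simp

lemma sublinear_norm: "sublinear (norm :: 'v::real_normed_vector \<Rightarrow> real)"
  by (simp add: sublinear_def norm_triangle_ineq)

text \<open>
  The largest sublinear functional below \<open>p\<close> whose value at \<open>- y\<close> is at most \<open>- p y\<close>. It equals \<open>p\<close>
  for every \<open>y\<close> precisely when \<open>p\<close> is linear, so a minimal sublinear functional is linear.
\<close>

definition tilt :: "('v::real_vector \<Rightarrow> real) \<Rightarrow> 'v \<Rightarrow> 'v \<Rightarrow> real"
  where "tilt p y x = (INF t\<in>{0..}. p (x + t *\<^sub>R y) - t * p y)"

text \<open>The infimum in \<open>tilt\<close> is informative only over a set bounded below.
  Subadditivity at \<open>(x + t *\<^sub>R y) + (- x)\<close> supplies the bound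
  \<open>- p (- x)\<close>, which is independent of \<open>t\<close>.\<close>

lemma tilt_bdd_below:
  assumes "sublinear p"
  shows "bdd_below ((\<lambda>t. p (x + t *\<^sub>R y) - t * p y) ` {0..})"
proof (rule bdd_belowI2)
  fix t :: real assume "t \<in> {0..}"
  then have "t * p y \<le> p (x + t *\<^sub>R y) + p (- x)"
    using sublinear_add[OF assms, of "x + t *\<^sub>R y" "- x"] sublinear_scaleR[OF assms, of t y] by simp
  then show "- p (- x) \<le> p (x + t *\<^sub>R y) - t * p y" by simp
qed

lemma tilt_le:
  assumes "sublinear p" "0 \<le> t"
  shows "tilt p y x \<le> p (x + t *\<^sub>R y) - t * p y"
  unfolding tilt_def by (rule cINF_lower[OF tilt_bdd_below[OF assms(1)]]) (use assms in auto)

lemma tilt_greatest: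
  assumes "\<And>t. 0 \<le> t \<Longrightarrow> m \<le> p (x + t *\<^sub>R y) - t * p y"
  shows "m \<le> tilt p y x"
  unfolding tilt_def by (rule cINF_greatest) (use assms in auto)

lemma tilt_le_self: "sublinear p \<Longrightarrow> tilt p y x \<le> p x"
  using tilt_le[of p 0 y x] by simp

text \<open>Parameters add: \<open>s\<close> for \<open>x\<close> and \<open>t\<close> for
  \<open>z\<close> give the parameter \<open>s + t\<close> for \<open>x + z\<close>. Homogeneity
  comes from rescaling the parameter by \<open>r\<close>.\<close>

lemma sublinear_tilt:
  assumes p: "sublinear p"
  shows "sublinear (tilt p y)"
  unfolding sublinear_def
proof (intro conjI allI impI)
  fix x z
  have "tilt p y (x + z) - (p (z + t *\<^sub>R y) - t * p y) \<le> tilt p y x" if t: "0 \<le> t" for t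
  proof (rule tilt_greatest)
    fix s :: real assume s: "0 \<le> s"
    have "tilt p y (x + z) \<le> p ((x + s *\<^sub>R y) + (z + t *\<^sub>R y)) - (s + t) * p y"
      using tilt_le[OF p, of "s + t" y "x + z"] s t by (simp add: algebra_simps)
    then show "tilt p y (x + z) - (p (z + t *\<^sub>R y) - t * p y) \<le> p (x + s *\<^sub>R y) - s * p y"
      using sublinear_add[OF p, of "x + s *\<^sub>R y" "z + t *\<^sub>R y"] by (simp add: algebra_simps)
  qed
  then have "tilt p y (x + z) - tilt p y x \<le> tilt p y z"
    by (intro tilt_greatest) (simp add: algebra_simps)
  then show "tilt p y (x + z) \<le> tilt p y x + tilt p y z" by simp
next
  fix r :: real and x assume r: "0 \<le> r"
  \<comment> \<open>The reverse inequality is this one for \<open>inverse r\<close> and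
    \<open>r *\<^sub>R x\<close>.\<close>
  have le: "r * tilt p y x \<le> tilt p y (r *\<^sub>R x)" if r: "0 < r" for r x
  proof (rule tilt_greatest)
    fix t :: real assume "0 \<le> t"
    then have "tilt p y x \<le> p (x + (t / r) *\<^sub>R y) - t / r * p y"
      using r by (intro tilt_le p) simp
    then have "r * tilt p y x \<le> r * p (x + (t / r) *\<^sub>R y) - t * p y"
      using mult_left_mono[of _ _ r] r by (fastforce simp: algebra_simps)
    also have "r * p (x + (t / r) *\<^sub>R y) = p (r *\<^sub>R x + t *\<^sub>R y)"
      using sublinear_scaleR[OF p, of r "x + (t / r) *\<^sub>R y"] r by (simp add: scaleR_add_right)
    finally show "r * tilt p y x \<le> p (r *\<^sub>R x + t *\<^sub>R y) - t * p y" .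
  qed
  show "tilt p y (r *\<^sub>R x) = r * tilt p y x"
  proof (cases "r = 0")
    case True
    have "0 \<le> tilt p y 0"
      by (rule tilt_greatest) (simp add: sublinear_scaleR[OF p])
    moreover have "tilt p y 0 \<le> 0"
      using tilt_le_self[OF p, of y 0] by (simp add: sublinear_zero[OF p])
    ultimately show ?thesis using True by simp
  next
    case False
    with r have "0 < r" by simp
    moreover have "inverse r * tilt p y (r *\<^sub>R x) \<le> tilt p y x"
      using le[of "inverse r" "r *\<^sub>R x"] \<open>0 < r\<close> by simp
    ultimately show ?thesis
      using le[of r x] by (simp add: field_simps)
  qed
qed

text \<open>Tilting cannot lower a minimal \<open>p\<close>, and the parameter 1 in the tilt then
  gives superadditivity.\<close>

lemma minimal_sublinear_linear:
  assumes p: "sublinear p"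
    and min: "\<And>q. sublinear q \<Longrightarrow> q \<le> p \<Longrightarrow> q = p"
  shows "linear p"
proof -
  have "tilt p y = p" for y
    by (rule min) (auto simp: sublinear_tilt p le_fun_def tilt_le_self)
  then have "p x \<le> p (x + y) - p y" for x y
    using tilt_le[OF p, of 1 y x] by simp
  then have add: "p (x + y) = p x + p y" for x y
    using sublinear_add[OF p, of x y] by (smt (verit))
  have neg: "p (- x) = - p x" for x
    using add[of x "- x"] sublinear_zero[OF p] by simp
  have "p (r *\<^sub>R x) = r * p x" for r x
  proof (cases "0 \<le> r")
    case False
    then show ?thesis
      using sublinear_scaleR[OF p, of "- r" x] neg[of "r *\<^sub>R x"] by simp
  qed (simp add: sublinear_scaleR p)
  with add show ?thesis by (intro linearI) auto
qed

text \<open>Subadditivity survives the infimum because, of two members of a chain, the smaller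
  serves at both points. The common bound \<open>q\<close> keeps the infima finite through
  \<open>- q (- x) \<le> - p (- x) \<le> p x\<close>.\<close>

lemma sublinear_INF_chain:
  assumes C: "C \<noteq> {}" "\<And>p. p \<in> C \<Longrightarrow> sublinear p" "\<And>p. p \<in> C \<Longrightarrow> p \<le> q"
    and chain: "\<And>p p'. p \<in> C \<Longrightarrow> p' \<in> C \<Longrightarrow> p \<le> p' \<or> p' \<le> p"
  shows "sublinear (\<lambda>x. INF p\<in>C. p x)" and "\<And>p x. p \<in> C \<Longrightarrow> (INF p\<in>C. p x) \<le> p x"
proof -
  let ?m = "\<lambda>x. INF p\<in>C. p x"
  have bdd: "bdd_below ((\<lambda>p. p x) ` C)" for x
  proof (rule bdd_belowI2)
    fix p assume "p \<in> C"
    then show "- q (- x) \<le> p x"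
      using sublinear_minus[of p x] C(2) C(3)[of p] by (smt (verit) le_funD)
  qed
  show low: "?m x \<le> p x" if "p \<in> C" for p x
    by (rule cINF_lower[OF bdd that])
  have great: "m \<le> ?m x" if "\<And>p. p \<in> C \<Longrightarrow> m \<le> p x" for m x
    by (rule cINF_greatest[OF C(1) that])
  show "sublinear ?m"
    unfolding sublinear_def
  proof (intro conjI allI impI)
    fix x y
    have "?m (x + y) \<le> p x + p' y" if pp: "p \<in> C" "p' \<in> C" for p p'
    proof -
      obtain r where r: "r \<in> C" "r \<le> p" "r \<le> p'"
        using chain[OF pp] pp by auto
      have "?m (x + y) \<le> r (x + y)" by (rule low[OF r(1)])
      also have "\<dots> \<le> r x + r y" by (rule sublinear_add[OF C(2)[OF r(1)]])
      also have "\<dots> \<le> p x + p' y" using r by (intro add_mono) (auto simp: le_fun_def)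
      finally show ?thesis .
    qed
    then have "?m (x + y) - p' y \<le> ?m x" if "p' \<in> C" for p'
      using that by (intro great) (simp add: algebra_simps)
    then have "?m (x + y) - ?m x \<le> ?m y"
      by (intro great) (simp add: algebra_simps)
    then show "?m (x + y) \<le> ?m x + ?m y" by simp
  next
    fix r :: real and x assume r: "0 \<le> r"
    show "?m (r *\<^sub>R x) = r * ?m x"
    proof (cases "r = 0")
      case True
      have "(\<lambda>p. p 0) ` C = {0}"
        using C(1,2) sublinear_zero by (auto simp: image_iff)
      with True show ?thesis by simp
    next
      case False
      with r have r: "0 < r" by simp
      have sc: "p (r *\<^sub>R x) = r * p x" if "p \<in> C" for p
        using sublinear_scaleR[OF C(2)[OF that]] r by simp
      have "?m (r *\<^sub>R x) / r \<le> p x" if "p \<in> C" for p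
        using low[OF that, of "r *\<^sub>R x"] sc[OF that] r by (simp add: divide_le_eq mult.commute)
      then have "?m (r *\<^sub>R x) / r \<le> ?m x" by (rule great)
      moreover have "r * ?m x \<le> p (r *\<^sub>R x)" if "p \<in> C" for p
        using low[OF that, of x] sc[OF that] r by simp
      then have "r * ?m x \<le> ?m (r *\<^sub>R x)" by (rule great)
      ultimately show ?thesis using r by (simp add: field_simps)
    qed
  qed
qed

theorem Hahn_Banach_sublinear:
  fixes q :: "'v::real_vector \<Rightarrow> real"
  assumes q: "sublinear q"
  obtains f where "linear f" "f \<le> q"
proof -
  define S where "S = {p. sublinear p \<and> p \<le> q}"
  have "\<exists>m\<in>S. \<forall>p\<in>S. m \<ge> p \<longrightarrow> p = m"
  proof (rule predicate_Zorn)
    \<comment> \<open>Zorn's lemma yields maximal elements; the order is reversed to obtain a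
      minimal sublinear functional below \<open>q\<close>.\<close>
    show "partial_order_on S (relation_of (\<lambda>x y. x \<ge> y) S)"
      by (rule partial_order_on_relation_ofI) auto
    fix C assume C: "C \<in> Chains (relation_of (\<lambda>x y. x \<ge> y) S)"
    show "\<exists>u\<in>S. \<forall>a\<in>C. a \<ge> u"
    proof (cases "C = {}")
      case True
      then show ?thesis using q by (auto simp: S_def)
    next
      case False
      have CS: "C \<subseteq> S" and ch: "\<And>p p'. p \<in> C \<Longrightarrow> p' \<in> C \<Longrightarrow> p \<le> p' \<or> p' \<le> p"
        using C by (auto simp: Chains_def relation_of_def)
      from CS have *: "\<And>p. p \<in> C \<Longrightarrow> sublinear p" "\<And>p. p \<in> C \<Longrightarrow> p \<le> q"
        by (auto simp: S_def)
      let ?m = "\<lambda>x. INF p\<in>C. p x"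
      have low: "?m \<le> p" if "p \<in> C" for p
        using sublinear_INF_chain(2)[OF False * ch that] by (simp add: le_fun_def)
      then have "?m \<le> q" using False *(2) by (meson all_not_in_conv order_trans)
      then have "?m \<in> S" using sublinear_INF_chain(1)[OF False * ch] by (simp add: S_def)
      then show ?thesis using low by blast
    qed
  qed
  then obtain m where m: "sublinear m" "m \<le> q" "\<And>p. sublinear p \<Longrightarrow> p \<le> m \<Longrightarrow> p = m"
    by (auto simp: S_def intro: order_trans)
  then show thesis using minimal_sublinear_linear that by blast
qed

text \<open>Instead of extending a functional from the line through \<open>a\<close>, the norm is
  tilted at \<open>a\<close>: anything linear below the tilt satisfies
  \<open>f (- a) \<le> - norm a\<close>, so \<open>f\<close> attains the norm at
  \<open>a\<close>.\<close>

corollary norming_functional_real: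
  fixes a :: "'v::real_normed_vector"
  obtains f :: "'v \<Rightarrow> real" where "linear f" "\<And>x. f x \<le> norm x" "f a = norm a"
proof -
  obtain f where f: "linear f" "f \<le> tilt norm a"
    using Hahn_Banach_sublinear[OF sublinear_tilt[OF sublinear_norm]] by blast
  have le: "f x \<le> norm x" for x
    using le_funD[OF f(2), of x] tilt_le_self[OF sublinear_norm, of a x] by simp
  have "f (- a) \<le> - norm a"
    using le_funD[OF f(2), of "- a"] tilt_le[OF sublinear_norm, of 1 a "- a"] by simp
  then have "norm a \<le> f a" using linear_neg[OF f(1)] by simp
  with le[of a] show thesis using that f(1) le by (simp add: antisym)
qed

subsection \<open>Elementary identities in C*-algebras\<close>

lemma scaleC_zero_left [simp]: "0 *\<^sub>C x = (0 :: 'a::unital_cstar_algebra)"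
  using scaleC_add_left[of 0 0 x] by simp

lemma scaleC_zero_right [simp]: "c *\<^sub>C 0 = (0 :: 'a::unital_cstar_algebra)"
  using scaleC_add_right[of c 0 0] by simp

lemma scaleC_minus_left: "(- c) *\<^sub>C x = - (c *\<^sub>C (x :: 'a::unital_cstar_algebra))"
  using scaleC_add_left[of "- c" c x] by (simp add: eq_neg_iff_add_eq_0)

lemma scaleC_minus_right: "c *\<^sub>C (- x) = - (c *\<^sub>C (x :: 'a::unital_cstar_algebra))"
  using scaleC_add_right[of c "- x" x] by (simp add: eq_neg_iff_add_eq_0)

lemma scaleC_diff_left: "(a - b) *\<^sub>C x = a *\<^sub>C x - b *\<^sub>C (x :: 'a::unital_cstar_algebra)"
  using scaleC_add_left[of a "- b" x] by (simp add: scaleC_minus_left)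

lemma scaleC_diff_right: "c *\<^sub>C (x - y) = c *\<^sub>C x - c *\<^sub>C (y :: 'a::unital_cstar_algebra)"
  using scaleC_add_right[of c x "- y"] by (simp add: scaleC_minus_right)

lemma scaleC_sum_left: "(\<Sum>i\<in>I. c i) *\<^sub>C x = (\<Sum>i\<in>I. c i *\<^sub>C (x :: 'a::unital_cstar_algebra))"
  by (induction I rule: infinite_finite_induct) (auto simp: scaleC_add_left)

lemma scaleC_sum_right: "c *\<^sub>C (\<Sum>i\<in>I. x i) = (\<Sum>i\<in>I. c *\<^sub>C (x i :: 'a::unital_cstar_algebra))"
  by (induction I rule: infinite_finite_induct) (auto simp: scaleC_add_right)

lemma star_zero [simp]: "star (0 :: 'a::unital_cstar_algebra) = 0"
  using star_add[of 0 0] by simp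

lemma star_one [simp]: "star (1 :: 'a::unital_cstar_algebra) = 1"
  using star_mult[of "star 1" "1::'a"] by (simp add: star_star)

lemma star_minus: "star (- x) = - star (x :: 'a::unital_cstar_algebra)"
  using star_add[of "- x" x] by (simp add: eq_neg_iff_add_eq_0)

lemma star_diff: "star (x - y) = star x - star (y :: 'a::unital_cstar_algebra)"
  using star_add[of x "- y"] by (simp add: star_minus)

text \<open>The C*-identity and submultiplicativity bound \<open>norm x\<close> by
  \<open>norm (star x)\<close>; applying this to \<open>star x\<close> as well gives
  equality.\<close>

lemma norm_star [simp]: "norm (star x) = norm (x :: 'a::unital_cstar_algebra)"
proof -
  have le: "norm x \<le> norm (star x)" for x :: 'a
  proof (cases "x = 0")
    case False
    have "norm x * norm x \<le> norm (star x) * norm x"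
      using norm_mult_ineq[of "star x" x] by (simp add: cstar_identity power2_eq_square)
    with False show ?thesis by simp
  qed simp
  show ?thesis using le[of x] le[of "star x"] by (simp add: star_star)
qed

lemma re_part_scaleC: "re_part (c *\<^sub>C x) = (1 / 2) *\<^sub>C (c *\<^sub>C x + cnj c *\<^sub>C star (x :: 'a::unital_cstar_algebra))"
  by (simp add: re_part_def star_scaleC)

lemma star_re_part [simp]: "star (re_part x) = re_part (x :: 'a::unital_cstar_algebra)"
  by (simp add: re_part_def star_scaleC star_add star_star add.commute)

lemma re_part_add: "re_part (x + y) = re_part x + re_part (y :: 'a::unital_cstar_algebra)"
  by (simp add: re_part_def star_add scaleC_add_right algebra_simps)

lemma re_part_diff: "re_part (x - y) = re_part x - re_part (y :: 'a::unital_cstar_algebra)"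
  by (simp add: re_part_def star_diff scaleC_add_right scaleC_diff_right algebra_simps)

lemma norm_re_part_le: "norm (re_part x) \<le> norm (x :: 'a::unital_cstar_algebra)"
  using norm_triangle_ineq[of x "star x"] by (simp add: re_part_def norm_scaleC)

lemma im_part_eq_re_part: "im_part x = re_part ((- \<i>) *\<^sub>C (x :: 'a::unital_cstar_algebra))"
proof -
  have "1 / (2 * \<i>) = - (\<i> / 2)" by (simp add: divide_simps)
  then show ?thesis
    unfolding im_part_def re_part_scaleC
    by (simp add: scaleC_diff_right scaleC_add_right scaleC_scaleC
        scaleC_minus_left scaleC_minus_right)
qed

text \<open>Powers of \<open>a\<close> are again self-adjoint, so each use of the C*-identity
  doubles the exponent.\<close>

lemma norm_power_selfadjoint:
  fixes a :: "'a::unital_cstar_algebra"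
  assumes "star a = a"
  shows "norm (a ^ 2 ^ k) = norm a ^ 2 ^ k"
proof -
  have st: "star (a ^ n) = a ^ n" for n
    by (induction n) (simp_all add: star_mult assms power_commutes)
  show ?thesis
  proof (induction k)
    case (Suc k)
    have "norm (a ^ 2 ^ Suc k) = norm (star (a ^ 2 ^ k) * a ^ 2 ^ k)"
      by (simp add: st mult_2 power_add)
    then show ?case
      by (simp add: cstar_identity Suc.IH power_mult mult.commute[of 2])
  qed simp
qed

lemma norm_square_selfadjoint:
  "star a = a \<Longrightarrow> norm (a * a) = (norm (a :: 'a::unital_cstar_algebra))\<^sup>2"
  using cstar_identity[of a] by simp

text \<open>Turns a large norm of a sum into a large norm of a product. The mixed terms of the
  expanded square have equal norm, since \<open>b * a = star (a * b)\<close>.\<close>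

lemma norm_add_selfadjoint_le:
  fixes a b :: "'a::unital_cstar_algebra"
  assumes a: "star a = a" and b: "star b = b"
  shows "(norm (a + b))\<^sup>2 \<le> (norm a)\<^sup>2 + (norm b)\<^sup>2 + 2 * norm (a * b)"
proof -
  have "norm (b * a) = norm (a * b)"
    using norm_star[of "a * b"] by (simp only: star_mult a b)
  moreover have "(norm (a + b))\<^sup>2 = norm (a * a + b * b + (a * b + b * a))"
    using norm_square_selfadjoint[of "a + b"] a b by (simp add: star_add algebra_simps)
  moreover have "\<dots> \<le> norm (a * a) + norm (b * b) + (norm (a * b) + norm (b * a))"
    by (intro norm_triangle_le add_mono norm_triangle_ineq)
  ultimately show ?thesis by (simp add: norm_square_selfadjoint a b)
qed

section \<open>Binomial expansion and roots of unity\<close>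

lemma binomial_scaleC:
  fixes b :: "'a::unital_cstar_algebra"
  shows "(1 + z *\<^sub>C b) ^ n = (\<Sum>k\<le>n. (of_nat (n choose k) * z ^ k) *\<^sub>C b ^ k)"
proof (induction n)
  case (Suc n)
  have "(1 + z *\<^sub>C b) ^ Suc n = (\<Sum>k\<le>n. (of_nat (n choose k) * z ^ k) *\<^sub>C b ^ k)
      + (\<Sum>k\<le>n. (of_nat (n choose k) * z ^ Suc k) *\<^sub>C b ^ Suc k)"
    by (simp add: Suc distrib_right scaleC_sum_right sum_distrib_left sum.distrib mult_scaleC_left
        mult_scaleC_right scaleC_scaleC scaleC_add_right mult_ac)
  \<comment> \<open>The added term has binomial coefficient 0; with it, the index shift leaves two
    sums over the same range.\<close>
  also have "(\<Sum>k\<le>n. (of_nat (n choose k) * z ^ k) *\<^sub>C b ^ k)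
      = (\<Sum>k\<le>Suc n. (of_nat (n choose k) * z ^ k) *\<^sub>C b ^ k)"
    by (simp add: binomial_eq_0)
  also have "\<dots> = 1 + (\<Sum>k\<le>n. (of_nat (n choose Suc k) * z ^ Suc k) *\<^sub>C b ^ Suc k)"
    by (subst sum.atMost_Suc_shift) (simp add: scaleC_one)
  also have "\<dots> + (\<Sum>k\<le>n. (of_nat (n choose k) * z ^ Suc k) *\<^sub>C b ^ Suc k)
      = 1 + (\<Sum>k\<le>n. (of_nat (Suc n choose Suc k) * z ^ Suc k) *\<^sub>C b ^ Suc k)"
    by (simp add: scaleC_add_left distrib_right sum.distrib add_ac)
  also have "\<dots> = (\<Sum>k\<le>Suc n. (of_nat (Suc n choose k) * z ^ k) *\<^sub>C b ^ k)"
    by (subst sum.atMost_Suc_shift) (simp add: scaleC_one del: binomial_Suc_Suc)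
  finally show ?case .
qed (simp add: scaleC_one)

text \<open>Orthogonality of the characters of the cyclic group of order \<open>m\<close>: the sum
  is geometric, and as both exponents are below \<open>m\<close>, its ratio is 1 only for
  \<open>k = n\<close>.\<close>

lemma sum_cis_root_of_unity:
  assumes "k < m" "n < m"
  shows "(\<Sum>j<m. cis (2 * pi * real j / real m) ^ k * cnj (cis (2 * pi * real j / real m)) ^ n)
    = (if k = n then of_nat m else 0)"
proof -
  define q where "q = cis (2 * pi * (real k - real n) / real m)"
  have m: "0 < m" using assms by simp
  have "(\<Sum>j<m. cis (2 * pi * real j / real m) ^ k * cnj (cis (2 * pi * real j / real m)) ^ n)
      = (\<Sum>j<m. q ^ j)"
    by (intro sum.cong refl)
      (simp add: q_def cis_cnj Complex.DeMoivre cis_mult field_simps)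
  also have "\<dots> = (if k = n then of_nat m else 0)"
  proof (cases "k = n")
    case False
    have "q \<noteq> 1"
    proof
      assume "q = 1"
      then obtain i :: int where i: "2 * pi * (real k - real n) / real m = of_int i * 2 * pi"
        by (auto simp: q_def cis_conv_exp exp_eq_1 mult_ac)
      have "real k - real n = of_int i * real m"
      proof -
        have "pi * (2 * (real k - real n)) = pi * (2 * (of_int i * real m))"
          using i m by (simp add: field_simps)
        then show ?thesis by simp
      qed
      then have "int k - int n = i * int m"
        by (metis of_int_diff of_int_eq_iff of_int_mult of_int_of_nat_eq)
      then have "int k mod int m = int n mod int m"
        by (simp add: mod_eq_dvd_iff)
      with assms False show False by simp
    qed
    moreover have "q ^ m = 1"
      using m by (simp add: q_def Complex.DeMoivre)
    ultimately show ?thesis using False by (simp add: sum_gp_strict)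
  qed (simp add: q_def)
  finally show ?thesis .
qed

subsection \<open>States norming self-adjoint elements\<close>

text \<open>
  Averaging \<open>(1 + \<zeta> b)\<^sup>2\<^sup>n\<close> against \<open>\<zeta>\<^sup>-\<^sup>n\<close> over the roots of unity isolates the central term
  \<open>(2n choose n) b\<^sup>n\<close>. For \<open>n = 2\<^sup>k\<close> this has norm at least \<open>4\<^sup>n / 2n\<close>, so the maximum of
  \<open>norm (1 + \<zeta> b)\<close> on the circle cannot be below 2. This replaces spectral theory.
\<close>

lemma selfadjoint_unit_circle_norm_two:
  fixes b :: "'a::unital_cstar_algebra"
  assumes b: "star b = b" "norm b = 1"
  obtains z where "cmod z = 1" "norm (1 + z *\<^sub>C b) = 2"
proof -
  have lip: "dist (norm (1 + u *\<^sub>C b)) (norm (1 + w *\<^sub>C b)) \<le> dist u w" for u w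
    using norm_triangle_ineq3[of "1 + u *\<^sub>C b" "1 + w *\<^sub>C b"]
    by (simp add: dist_norm norm_scaleC b flip: scaleC_diff_left)
  then have cont: "continuous_on (sphere 0 1) (\<lambda>z. norm (1 + z *\<^sub>C b))"
    unfolding continuous_on_iff by (meson le_less_trans)
  have "sphere 0 1 \<noteq> ({} :: complex set)"
    by simp
  then obtain w where w: "cmod w = 1"
    and max: "\<And>z. cmod z = 1 \<Longrightarrow> norm (1 + z *\<^sub>C b) \<le> norm (1 + w *\<^sub>C b)"
    using continuous_attains_sup[OF _ _ cont] by (auto simp: dist_norm)
  define M where "M = norm (1 + w *\<^sub>C b)"
  have M0: "0 \<le> M" by (simp add: M_def)
  have M2: "M \<le> 2"
    using norm_triangle_ineq[of 1 "w *\<^sub>C b"] by (simp add: M_def norm_scaleC b w)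
  have binom: "real (2 * n choose n) * norm (b ^ n) \<le> M ^ (2 * n)" for n
  proof -
    \<comment> \<open>More roots than the largest exponent \<open>2 * n\<close>, so that no other
      term of the expansion is congruent to the central one modulo \<open>m\<close>.\<close>
    define m where "m = Suc (2 * n)"
    define \<zeta> where "\<zeta> = (\<lambda>j. cis (2 * pi * real j / real m))"
    have "(\<Sum>j<m. cnj (\<zeta> j) ^ n *\<^sub>C (1 + \<zeta> j *\<^sub>C b) ^ (2 * n))
        = (\<Sum>k\<le>2 * n. (\<Sum>j<m. of_nat (2 * n choose k) * (\<zeta> j ^ k * cnj (\<zeta> j) ^ n)) *\<^sub>C b ^ k)"
      unfolding binomial_scaleC scaleC_sum_right scaleC_sum_left scaleC_scaleC
      by (subst sum.swap) (simp add: mult_ac)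
    also have "\<dots> = (\<Sum>k\<le>2 * n. (if k = n then of_nat (2 * n choose n) * of_nat m else 0) *\<^sub>C b ^ k)"
      unfolding sum_distrib_left[symmetric] \<zeta>_def
      by (intro sum.cong refl arg_cong2[where f = scaleC]) (subst sum_cis_root_of_unity; simp add: m_def)
    also have "\<dots> = (of_nat (2 * n choose n) * of_nat m) *\<^sub>C b ^ n"
      by (simp add: if_distrib[of "\<lambda>c. c *\<^sub>C _"] sum.delta cong: if_cong)
    finally have "real (2 * n choose n) * real m * norm (b ^ n)
        = norm (\<Sum>j<m. cnj (\<zeta> j) ^ n *\<^sub>C (1 + \<zeta> j *\<^sub>C b) ^ (2 * n))"
      by (simp add: norm_scaleC norm_mult)
    also have "\<dots> \<le> (\<Sum>j<m. M ^ (2 * n))"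
    proof (rule sum_norm_le)
      fix j
      have "norm ((1 + \<zeta> j *\<^sub>C b) ^ (2 * n)) \<le> norm (1 + \<zeta> j *\<^sub>C b) ^ (2 * n)"
        by (rule norm_power_ineq)
      also have "\<dots> \<le> M ^ (2 * n)"
        using max[of "\<zeta> j"] by (intro power_mono) (simp_all add: M_def \<zeta>_def)
      finally show "norm (cnj (\<zeta> j) ^ n *\<^sub>C (1 + \<zeta> j *\<^sub>C b) ^ (2 * n)) \<le> M ^ (2 * n)"
        by (simp add: norm_scaleC norm_power \<zeta>_def)
    qed
    finally have "real m * (real (2 * n choose n) * norm (b ^ n)) \<le> real m * M ^ (2 * n)"
      by (simp add: mult_ac)
    then show ?thesis by (simp add: m_def)
  qed
  have "M = 2"
  proof (rule ccontr)
    assume "M \<noteq> 2"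
    \<comment> \<open>The ratio of the growth rates of \<open>M ^ (2 * n)\<close> and
      \<open>4 ^ n\<close>. If it is below 1, then \<open>n * q ^ n\<close> tends to 0, against the
      lower bound on the central coefficient.\<close>
    define q where "q = M\<^sup>2 / 4"
    have "M\<^sup>2 < 2\<^sup>2" using M0 M2 \<open>M \<noteq> 2\<close> by (intro power_strict_mono) auto
    then have q: "0 \<le> q" "q < 1" by (simp_all add: q_def)
    have lower: "1 \<le> real (2 * 2 ^ k) * q ^ 2 ^ k" for k
    proof -
      \<comment> \<open>For these exponents \<open>norm (b ^ ?n) = 1\<close> is known.\<close>
      let ?n = "2 ^ k :: nat"
      have "4 ^ ?n / (2 * real ?n) \<le> real (2 * ?n choose ?n)"
        by (rule central_binomial_lower_bound) simp
      also have "\<dots> \<le> M ^ (2 * ?n)"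
        using binom[of ?n] norm_power_selfadjoint[OF b(1), of k] b(2) by simp
      also have "\<dots> = 4 ^ ?n * q ^ ?n"
        by (simp add: q_def power_divide power_mult)
      finally show ?thesis by (simp add: field_simps)
    qed
    have "(\<lambda>n. real n * q ^ n) \<longlonglongrightarrow> 0"
      using powser_times_n_limit_0[of q] q by simp
    then have "(\<lambda>k. real (2 ^ k) * q ^ 2 ^ k) \<longlonglongrightarrow> 0"
      by (rule LIMSEQ_subseq_LIMSEQ[unfolded o_def]) (simp add: strict_mono_def)
    then have "eventually (\<lambda>k. real (2 ^ k) * q ^ 2 ^ k < 1 / 2) sequentially"
      by (rule order_tendstoD) simp
    then obtain k where "real (2 ^ k) * q ^ 2 ^ k < 1 / 2"
      by (auto simp: eventually_sequentially)
    with lower[of k] show False by simp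
  qed
  with w show thesis using that by (simp add: M_def)
qed

lemma eq_of_real_if_norm_le_Re:
  assumes "cmod w \<le> r" "r \<le> Re w"
  shows "w = complex_of_real r"
proof -
  have "Re w = r" "cmod w = r"
    using assms complex_Re_le_cmod[of w] by linarith+
  then show ?thesis using cmod_power2[of w] by (simp add: complex_eq_iff)
qed

text \<open>A complex-linear functional is determined by its real part \<open>f\<close> through
  \<open>f x - i f(i x)\<close>. Passing from \<open>f\<close> to it preserves the norm bound, and
  equality at \<open>a\<close> forces a real value there.\<close>

lemma norming_functional:
  fixes a :: "'a::unital_cstar_algebra"
  obtains \<phi> where "\<phi> \<in> dual_space" "\<And>x. cmod (\<phi> x) \<le> norm x" "\<phi> a = complex_of_real (norm a)"
proof -
  obtain f :: "'a \<Rightarrow> real" where f: "linear f" "\<And>x. f x \<le> norm x" "f a = norm a"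
    using norming_functional_real by blast
  interpret linear f by (fact f(1))
  define \<phi> where "\<phi> x = Complex (f x) (- f (\<i> *\<^sub>C x))" for x
  have \<phi>_add: "\<phi> (x + y) = \<phi> x + \<phi> y" for x y
    by (simp add: \<phi>_def scaleC_add_right add complex_eq_iff)
  have \<phi>_real: "\<phi> (complex_of_real r *\<^sub>C x) = r * \<phi> x" for r x
  proof -
    have "\<i> *\<^sub>C complex_of_real r *\<^sub>C x = r *\<^sub>R (\<i> *\<^sub>C x)"
      by (simp add: scaleR_scaleC scaleC_scaleC mult.commute)
    then show ?thesis by (simp add: \<phi>_def complex_eq_iff scale flip: scaleR_scaleC)
  qed
  have \<phi>_i: "\<phi> (\<i> *\<^sub>C x) = \<i> * \<phi> x" for x
    by (simp add: \<phi>_def scaleC_scaleC scaleC_minus_left scaleC_one neg complex_eq_iff)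
  have \<phi>_scale: "\<phi> (c *\<^sub>C x) = c * \<phi> x" for c x
  proof -
    have "c *\<^sub>C x = complex_of_real (Re c) *\<^sub>C x + complex_of_real (Im c) *\<^sub>C \<i> *\<^sub>C x"
      by (subst complex_eq[of c]) (simp add: scaleC_add_left scaleC_scaleC mult.commute)
    then have "\<phi> (c *\<^sub>C x) = (complex_of_real (Re c) + \<i> * complex_of_real (Im c)) * \<phi> x"
      by (simp add: \<phi>_add \<phi>_real \<phi>_i algebra_simps)
    then show ?thesis by (simp flip: complex_eq)
  qed
  have le: "cmod (\<phi> x) \<le> norm x" for x
  proof (cases "\<phi> x = 0")
    case False
    \<comment> \<open>Rotates \<open>\<phi> x\<close> onto the positive reals, where the modulus is
      the real part and the bound on \<open>f\<close> applies.\<close>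
    define u where "u = cnj (sgn (\<phi> x))"
    have u: "cmod u = 1" using False by (simp add: u_def norm_sgn)
    have "\<phi> (u *\<^sub>C x) = complex_of_real (cmod (\<phi> x))"
      using False complex_norm_square[of "\<phi> x"]
      by (simp add: \<phi>_scale u_def sgn_eq mult.commute power2_eq_square divide_eq_eq)
    then have "cmod (\<phi> x) = f (u *\<^sub>C x)" by (simp add: \<phi>_def complex_eq_iff)
    also have "\<dots> \<le> norm x" using f(2)[of "u *\<^sub>C x"] u by (simp add: norm_scaleC)
    finally show ?thesis .
  qed simp
  have "bounded_linear \<phi>"
    using \<phi>_add \<phi>_real le
    by (intro bounded_linear_intro[where K = 1])
      (simp_all add: scaleR_scaleC[where 'a = 'a] scaleR_conv_of_real)
  then have "\<phi> \<in> dual_space" by (simp add: dual_space_def \<phi>_scale)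
  moreover have "\<phi> a = complex_of_real (norm a)"
    using eq_of_real_if_norm_le_Re[OF le[of a]] by (simp add: \<phi>_def f(3))
  ultimately show thesis using that le by blast
qed

section \<open>Basic properties of states\<close>

lemma statesI:
  assumes "\<phi> \<in> dual_space" "\<And>x. cmod (\<phi> x) \<le> norm x" "\<phi> 1 = 1"
  shows "\<phi> \<in> states"
proof -
  have bl: "bounded_linear \<phi>" using assms(1) by (simp add: dual_space_def)
  have "onorm \<phi> \<le> 1" by (rule onorm_bound) (use assms(2) in auto)
  moreover have "1 \<le> onorm \<phi>" using onorm[OF bl, of 1] assms(3) by simp
  ultimately show ?thesis using assms by (simp add: states_def)
qed

lemma stateD:
  assumes "\<phi> \<in> states"
  shows state_scaleC: "\<phi> (c *\<^sub>C x) = c * \<phi> x"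
    and state_add: "\<phi> (x + y) = \<phi> x + \<phi> y"
    and state_one: "\<phi> 1 = 1"
    and state_le_norm: "cmod (\<phi> x) \<le> norm x"
proof -
  have bl: "bounded_linear \<phi>" and on: "onorm \<phi> = 1"
    using assms by (auto simp: states_def dual_space_def)
  show "\<phi> (c *\<^sub>C x) = c * \<phi> x" "\<phi> 1 = 1"
    using assms by (auto simp: states_def dual_space_def)
  show "\<phi> (x + y) = \<phi> x + \<phi> y" using linear_add[OF bounded_linear.linear[OF bl]] .
  show "cmod (\<phi> x) \<le> norm x" using onorm[OF bl, of x] on by simp
qed

text \<open>Shifting \<open>a\<close> by the imaginary scalar \<open>i t\<close> adds only
  \<open>t\<^sup>2\<close> to the bound on the squared norm, whereas a nonzero imaginary part of
  \<open>\<phi> a\<close> would add a term linear in \<open>t\<close> to the squared value.\<close>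

lemma state_selfadjoint_real:
  assumes \<phi>: "\<phi> \<in> states" and a: "star a = a"
  shows "Im (\<phi> a) = 0"
proof (rule ccontr)
  assume nz: "Im (\<phi> a) \<noteq> 0"
  have bound: "(Re (\<phi> a))\<^sup>2 + (Im (\<phi> a) + t)\<^sup>2 \<le> (norm a)\<^sup>2 + t\<^sup>2" for t :: real
  proof -
    let ?c = "\<i> * complex_of_real t"
    have "(cmod (\<phi> (a + ?c *\<^sub>C 1)))\<^sup>2 \<le> (norm (a + ?c *\<^sub>C 1))\<^sup>2"
      by (intro power_mono state_le_norm \<phi>) simp
    also have "\<dots> = norm ((a - ?c *\<^sub>C 1) * (a + ?c *\<^sub>C 1))"
      by (subst cstar_identity[symmetric]) (simp add: star_add star_scaleC a scaleC_minus_left)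
    also have "(a - ?c *\<^sub>C 1) * (a + ?c *\<^sub>C 1) = a * a + complex_of_real (t\<^sup>2) *\<^sub>C 1"
    proof -
      have "?c * ?c = - complex_of_real (t\<^sup>2)" by (simp add: complex_eq_iff power2_eq_square)
      then show ?thesis
        by (simp add: left_diff_distrib distrib_left mult_scaleC_left mult_scaleC_right
            scaleC_scaleC scaleC_minus_left scaleC_diff_right)
    qed
    also have "norm \<dots> \<le> (norm a)\<^sup>2 + t\<^sup>2"
      using norm_triangle_ineq[of "a * a" "complex_of_real (t\<^sup>2) *\<^sub>C 1"]
      by (simp add: norm_square_selfadjoint a norm_scaleC norm_power)
    finally show ?thesis
      by (simp add: state_add[OF \<phi>] state_scaleC[OF \<phi>] state_one[OF \<phi>] cmod_power2)
  qed
  \<comment> \<open>Chosen so that the cross term \<open>2 * Im (\<phi> a) * t\<close> equals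
    \<open>(norm a)\<^sup>2\<close>.\<close>
  define t where "t = (norm a)\<^sup>2 / (2 * Im (\<phi> a))"
  have "(Im (\<phi> a) + t)\<^sup>2 = (Im (\<phi> a))\<^sup>2 + (norm a)\<^sup>2 + t\<^sup>2"
    using nz by (simp add: t_def power2_sum)
  moreover have "0 < (Im (\<phi> a))\<^sup>2" using nz by simp
  moreover have "0 \<le> (Re (\<phi> a))\<^sup>2" by simp
  ultimately show False using bound[of t] by linarith
qed

text \<open>Self-adjointness of the real parts of \<open>z\<close> and of \<open>i z\<close>
  together says that \<open>\<phi> (star z)\<close> is the conjugate of
  \<open>\<phi> z\<close>.\<close>

lemma state_re_part:
  assumes \<phi>: "\<phi> \<in> states"
  shows "\<phi> (re_part z) = complex_of_real (Re (\<phi> z))"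
proof -
  have im: "Im (\<phi> (re_part z)) = 0" for z by (rule state_selfadjoint_real[OF \<phi>]) simp
  have e: "\<phi> (re_part z) = (\<phi> z + \<phi> (star z)) / 2" for z
    by (simp add: re_part_def state_add[OF \<phi>] state_scaleC[OF \<phi>])
  have "Im (\<phi> z + \<phi> (star z)) = 0" using im[of z] e[of z] by simp
  moreover have "Re (\<phi> z - \<phi> (star z)) = 0"
    using im[of "\<i> *\<^sub>C z"] e[of "\<i> *\<^sub>C z"] by (simp add: star_scaleC state_scaleC[OF \<phi>])
  ultimately show ?thesis using e[of z] by (simp add: complex_eq_iff)
qed

text \<open>A functional of norm at most 1 with value 2 at \<open>1 + z *\<^sub>C b\<close> must
  take the value 1 at both summands. The first makes it a state, the second makes it norm
  \<open>b\<close>, the normalization of \<open>a\<close>.\<close>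

lemma selfadjoint_norming_state:
  fixes a :: "'a::unital_cstar_algebra"
  assumes a: "star a = a"
  obtains \<phi> where "\<phi> \<in> states" "cmod (\<phi> a) = norm a"
proof (cases "a = 0")
  case True
  \<comment> \<open>Any state will do here, and a functional norming 1 is one.\<close>
  obtain \<phi> :: "'a \<Rightarrow> complex" where "\<phi> \<in> dual_space"
    "\<And>x. cmod (\<phi> x) \<le> norm x" "\<phi> 1 = complex_of_real (norm (1 :: 'a))"
    using norming_functional by blast
  then have "\<phi> \<in> states" by (intro statesI) auto
  then show thesis using that state_le_norm[of \<phi> 0] True by simp
next
  case False
  define b where "b = complex_of_real (inverse (norm a)) *\<^sub>C a"
  have "star b = b" "norm b = 1"
    using False by (simp_all add: b_def star_scaleC a norm_scaleC norm_inverse)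
  then obtain z where z: "cmod z = 1" "norm (1 + z *\<^sub>C b) = 2"
    using selfadjoint_unit_circle_norm_two by blast
  obtain \<phi> :: "'a \<Rightarrow> complex" where \<phi>: "\<phi> \<in> dual_space"
    "\<And>x. cmod (\<phi> x) \<le> norm x" "\<phi> (1 + z *\<^sub>C b) = complex_of_real (norm (1 + z *\<^sub>C b))"
    using norming_functional by blast
  have lin: "linear \<phi>" "\<And>c x. \<phi> (c *\<^sub>C x) = c * \<phi> x"
    using \<phi>(1) by (auto simp: dual_space_def bounded_linear.linear)
  have sum: "\<phi> 1 + z * \<phi> b = 2"
    using \<phi>(3) z(2) by (simp add: linear_add[OF lin(1)] lin(2))
  have 1: "cmod (\<phi> 1) \<le> 1" and 2: "cmod (z * \<phi> b) \<le> 1"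
    using \<phi>(2)[of 1] \<phi>(2)[of b] \<open>norm b = 1\<close> z(1) by (simp_all add: norm_mult)
  have re: "Re (\<phi> 1) + Re (z * \<phi> b) = 2"
    using arg_cong[OF sum, of Re] by simp
  have "\<phi> 1 = 1"
    using re 1 2 complex_Re_le_cmod[of "z * \<phi> b"] eq_of_real_if_norm_le_Re[of "\<phi> 1" 1] by simp
  then have "\<phi> \<in> states" by (intro statesI \<phi>)
  moreover have "z * \<phi> b = 1" using sum \<open>\<phi> 1 = 1\<close> by simp
  then have "cmod (\<phi> b) = 1" using z(1) by (metis norm_mult norm_one mult_1)
  then have "cmod (\<phi> a) = norm a"
    using False by (simp add: b_def lin(2) norm_mult norm_divide field_simps)
  ultimately show thesis by (rule that)
qed

lemma bdd_above_states: "bdd_above ((\<lambda>\<phi>. cmod (\<phi> x)) ` states)"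
  by (rule bdd_aboveI2[where M = "norm x"]) (rule state_le_norm)

lemma state_le_numerical_radius: "\<phi> \<in> states \<Longrightarrow> cmod (\<phi> x) \<le> numerical_radius x"
  unfolding numerical_radius_def by (rule cSUP_upper[OF _ bdd_above_states])

text \<open>A state norming the real part takes there the real part of its value at
  \<open>c *\<^sub>C x\<close>, which has the same modulus as its value at \<open>x\<close>.\<close>

lemma norm_re_part_le_numerical_radius:
  fixes x :: "'a::unital_cstar_algebra"
  assumes "cmod c = 1"
  shows "norm (re_part (c *\<^sub>C x)) \<le> numerical_radius x"
proof -
  obtain \<phi> :: "'a \<Rightarrow> complex" where \<phi>: "\<phi> \<in> states"
    "cmod (\<phi> (re_part (c *\<^sub>C x))) = norm (re_part (c *\<^sub>C x))"
    using selfadjoint_norming_state[of "re_part (c *\<^sub>C x)"] by auto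
  then have "norm (re_part (c *\<^sub>C x)) \<le> cmod (\<phi> (c *\<^sub>C x))"
    by (simp add: state_re_part abs_Re_le_cmod flip: \<phi>(2))
  also have "\<dots> \<le> numerical_radius x"
    using state_le_numerical_radius[OF \<phi>(1), of x] assms by (simp add: state_scaleC[OF \<phi>(1)] norm_mult)
  finally show ?thesis .
qed

subsection \<open>Products of rotated real parts\<close>

lemma norm_re_part_cis_le: "norm (re_part (cis \<theta> *\<^sub>C z)) \<le> norm (z :: 'a::unital_cstar_algebra)"
  using norm_re_part_le[of "cis \<theta> *\<^sub>C z"] by (simp add: norm_scaleC)

lemma numerical_radius_nonneg: "0 \<le> numerical_radius (z :: 'a::unital_cstar_algebra)"
  by (rule order_trans[OF norm_ge_zero norm_re_part_le_numerical_radius[of 1]]) simp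

context
  fixes x y :: "'a::unital_cstar_algebra"
begin

text \<open>This is \<open>L(s)\<close> of the outline, and \<open>aligned_product_sup\<close> is
  \<open>R\<close>; both are shared by (i) and (ii).\<close>

definition shifted_product_sup :: "real \<Rightarrow> real"
  where "shifted_product_sup s = (SUP \<theta>. norm (re_part (cis \<theta> *\<^sub>C x) * re_part (cis (\<theta> + s) *\<^sub>C y)))"

lemma bdd_above_shifted_product:
  "bdd_above (range (\<lambda>\<theta>. norm (re_part (cis \<theta> *\<^sub>C x) * re_part (cis (\<theta> + s) *\<^sub>C y))))"
  by (rule bdd_aboveI2[where M = "norm x * norm y"])
    (intro order_trans[OF norm_mult_ineq] mult_mono norm_re_part_cis_le norm_ge_zero)

lemma norm_le_shifted_product_sup:
  "norm (re_part (cis \<theta> *\<^sub>C x) * re_part (cis (\<theta> + s) *\<^sub>C y)) \<le> shifted_product_sup s"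
  unfolding shifted_product_sup_def by (rule cSUP_upper[OF _ bdd_above_shifted_product]) simp

text \<open>Only the second factor depends on the shift, and its change is bounded uniformly in
  \<open>\<theta>\<close>. The error term is symmetric in \<open>s\<close> and \<open>t\<close>, so
  continuity follows.\<close>

lemma shifted_product_sup_le:
  "shifted_product_sup s \<le> shifted_product_sup t + norm x * (cmod (cis s - cis t) * norm y)"
  unfolding shifted_product_sup_def[of s]
proof (rule cSUP_least)
  fix \<theta>
  let ?a = "re_part (cis \<theta> *\<^sub>C x)" and ?b = "\<lambda>s. re_part (cis (\<theta> + s) *\<^sub>C y)"
  have "norm (?b s - ?b t) \<le> cmod (cis (\<theta> + s) - cis (\<theta> + t)) * norm y"
    using norm_re_part_le[of "(cis (\<theta> + s) - cis (\<theta> + t)) *\<^sub>C y"]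
    by (simp add: scaleC_diff_left re_part_diff flip: norm_scaleC)
  also have "cis (\<theta> + s) - cis (\<theta> + t) = cis \<theta> * (cis s - cis t)"
    by (simp add: right_diff_distrib cis_mult)
  finally have "norm (?a * (?b s - ?b t)) \<le> norm x * (cmod (cis s - cis t) * norm y)"
    by (intro order_trans[OF norm_mult_ineq] mult_mono norm_re_part_cis_le)
      (simp_all add: norm_mult)
  moreover have "norm (?a * ?b s) \<le> norm (?a * ?b t) + norm (?a * (?b s - ?b t))"
    using norm_triangle_ineq[of "?a * ?b t" "?a * (?b s - ?b t)"] by (simp add: right_diff_distrib)
  ultimately show "norm (?a * ?b s) \<le> shifted_product_sup t + norm x * (cmod (cis s - cis t) * norm y)"
    using norm_le_shifted_product_sup[of \<theta> t] by linarith
qed simp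

lemma isCont_shifted_product_sup: "isCont shifted_product_sup t"
proof -
  let ?d = "\<lambda>s. norm x * (cmod (cis s - cis t) * norm y)"
  have lim: "(?d \<longlongrightarrow> 0) (at t)"
    by (rule tendsto_eq_rhs[where x = "norm x * (cmod (cis t - cis t) * norm y)"])
      (intro tendsto_intros, simp)
  have "\<bar>shifted_product_sup s - shifted_product_sup t\<bar> \<le> ?d s" for s
    using shifted_product_sup_le[of s t] shifted_product_sup_le[of t s]
    by (simp add: norm_minus_commute abs_le_iff)
  then have "eventually (\<lambda>s. norm (shifted_product_sup s - shifted_product_sup t) \<le> ?d s) (at t)"
    by (simp add: always_eventually)
  from Lim_null_comparison[OF this lim] show ?thesis
    unfolding isCont_def by (rule LIM_zero_cancel)
qed

definition aligned_product_sup :: real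
  where "aligned_product_sup = (SUP \<theta>. norm (re_part (cis \<theta> *\<^sub>C x)) * norm (re_part (cis \<theta> *\<^sub>C y)))"

lemma shifted_le_aligned: "shifted_product_sup 0 \<le> aligned_product_sup"
  unfolding shifted_product_sup_def aligned_product_sup_def
proof (rule cSUP_mono)
  show "bdd_above (range (\<lambda>\<theta>. norm (re_part (cis \<theta> *\<^sub>C x)) * norm (re_part (cis \<theta> *\<^sub>C y))))"
    by (rule bdd_aboveI2[where M = "norm x * norm y"])
      (intro mult_mono norm_re_part_cis_le norm_ge_zero)
next
  fix \<theta> :: real
  show "\<exists>\<theta>'\<in>UNIV. norm (re_part (cis \<theta> *\<^sub>C x) * re_part (cis (\<theta> + 0) *\<^sub>C y))
      \<le> norm (re_part (cis \<theta>' *\<^sub>C x)) * norm (re_part (cis \<theta>' *\<^sub>C y))"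
    by (rule bexI[of _ \<theta>]) (simp_all add: norm_mult_ineq)
qed simp

lemma aligned_product_sup_le: "aligned_product_sup \<le> numerical_radius x * numerical_radius y"
  unfolding aligned_product_sup_def
  by (intro cSUP_least mult_mono norm_re_part_le_numerical_radius numerical_radius_nonneg) simp_all

lemma numerical_radius_le_shifted_product_sup:
  assumes par: "numerical_radius (x + cis s *\<^sub>C y) = numerical_radius x + numerical_radius y"
  shows "numerical_radius x * numerical_radius y \<le> shifted_product_sup s"
proof (rule ccontr)
  let ?v = numerical_radius
  assume less: "\<not> ?thesis"
  \<comment> \<open>The upper bound for \<open>(norm (a + b))\<^sup>2\<close> that
    \<open>norm_add_selfadjoint_le\<close> gives for any rotated real parts \<open>a\<close>,
    \<open>b\<close> with relative shift \<open>s\<close>.\<close>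
  define K where "K = (?v x)\<^sup>2 + (?v y)\<^sup>2 + 2 * shifted_product_sup s"
  have "0 \<le> shifted_product_sup s"
    using norm_le_shifted_product_sup[of 0 s] norm_ge_zero order_trans by blast
  then have K0: "0 \<le> K" by (simp add: K_def)
  have "K < (?v x + ?v y)\<^sup>2"
    using less by (simp add: K_def power2_sum)
  then have "sqrt K < ?v (x + cis s *\<^sub>C y)"
    using numerical_radius_nonneg[of x] numerical_radius_nonneg[of y] par by (simp add: real_less_lsqrt)
  \<comment> \<open>Some state must exist for a supremum above \<open>sqrt K\<close> to yield a
    state above \<open>sqrt K\<close>.\<close>
  moreover obtain \<psi> :: "'a \<Rightarrow> complex" where "\<psi> \<in> states"
    using selfadjoint_norming_state[of "1::'a"] by auto
  ultimately obtain \<phi> where \<phi>: "\<phi> \<in> states" and gt: "sqrt K < cmod (\<phi> (x + cis s *\<^sub>C y))"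
    unfolding numerical_radius_def using less_cSUP_iff[OF _ bdd_above_states] by blast
  \<comment> \<open>This rotation makes the value of \<open>\<phi>\<close> real and nonnegative, so
    nothing is lost on passing to real parts.\<close>
  define \<theta> where "\<theta> = - Arg (\<phi> (x + cis s *\<^sub>C y))"
  define a where "a = re_part (cis \<theta> *\<^sub>C x)"
  define b where "b = re_part (cis (\<theta> + s) *\<^sub>C y)"
  have ab: "a + b = re_part (cis \<theta> *\<^sub>C (x + cis s *\<^sub>C y))"
    by (simp add: a_def b_def scaleC_add_right scaleC_scaleC cis_mult re_part_add)
  have "cis \<theta> * \<phi> (x + cis s *\<^sub>C y) = complex_of_real (cmod (\<phi> (x + cis s *\<^sub>C y)))"
    by (subst (2) rcis_cmod_Arg[symmetric]) (simp add: \<theta>_def rcis_def cis_mult)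
  then have "cmod (\<phi> (x + cis s *\<^sub>C y)) = cmod (\<phi> (a + b))"
    by (simp add: ab state_re_part[OF \<phi>] state_scaleC[OF \<phi>])
  also have "\<dots> \<le> norm (a + b)" by (rule state_le_norm[OF \<phi>])
  finally have "K < (norm (a + b))\<^sup>2"
    using gt K0 by (smt (verit) real_le_rsqrt)
  also have "\<dots> \<le> (norm a)\<^sup>2 + (norm b)\<^sup>2 + 2 * norm (a * b)"
    by (rule norm_add_selfadjoint_le) (simp_all add: a_def b_def)
  also have "\<dots> \<le> K"
    unfolding K_def a_def b_def
    by (intro add_mono power_mono mult_left_mono norm_re_part_le_numerical_radius
        norm_le_shifted_product_sup norm_ge_zero) simp_all
  finally show False by simp
qed

lemma shifted_eq_aligned:
  assumes "x \<parallel>\<^sub>v y"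
  obtains s where "shifted_product_sup s = aligned_product_sup"
proof -
  obtain c where c: "cmod c = 1" "numerical_radius (x + c *\<^sub>C y) = numerical_radius x + numerical_radius y"
    using assms by (auto simp: numerical_radius_parallel_def)
  \<comment> \<open>This choice of argument is nonnegative, so the intermediate value theorem
    applies on the interval from 0 to \<open>t\<close>.\<close>
  define t where "t = Arg2pi c"
  have "c = cis t" using Arg2pi_eq[of c] c(1) by (simp add: t_def cis_conv_exp)
  with c(2) have "aligned_product_sup \<le> shifted_product_sup t"
    using numerical_radius_le_shifted_product_sup[of t] aligned_product_sup_le by simp
  moreover have "0 \<le> t" by (simp add: t_def Arg2pi_ge_0)
  ultimately show thesis
    using IVT[of shifted_product_sup 0 aligned_product_sup t] shifted_le_aligned
      isCont_shifted_product_sup that by auto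
qed

end

section \<open>Transfer from real to imaginary parts\<close>

lemma SUP_shift: "(SUP \<theta>::real. f (\<theta> - s)) = (SUP \<theta>. f \<theta> :: real)"
proof -
  have "range (\<lambda>\<theta>. f (\<theta> - s)) = f ` range (\<lambda>\<theta>. \<theta> - s)"
    by (simp only: image_image)
  then show ?thesis by simp
qed

lemma im_part_cis: "im_part (cis \<theta> *\<^sub>C z) = re_part (cis (\<theta> - pi / 2) *\<^sub>C z)"
proof -
  have "cis (\<theta> - pi / 2) = - \<i> * cis \<theta>"
    by (simp add: cis_divide[symmetric])
  then show ?thesis by (simp add: im_part_eq_re_part scaleC_scaleC)
qed

theorem corollary2p12:
  fixes x y :: "'a::unital_cstar_algebra"
  assumes "x \<parallel>\<^sub>v y"
  shows "\<exists>\<theta>\<^sub>0::real.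
    (SUP \<theta>::real. norm (re_part (exp (\<i> * complex_of_real \<theta>) *\<^sub>C x) *
                        re_part (exp (\<i> * complex_of_real (\<theta> + \<theta>\<^sub>0)) *\<^sub>C y)))
      = (SUP \<theta>::real. norm (re_part (exp (\<i> * complex_of_real \<theta>) *\<^sub>C x)) *
                       norm (re_part (exp (\<i> * complex_of_real \<theta>) *\<^sub>C y))) \<and>
    (SUP \<theta>::real. norm (im_part (exp (\<i> * complex_of_real \<theta>) *\<^sub>C x) *
                        im_part (exp (\<i> * complex_of_real (\<theta> + \<theta>\<^sub>0)) *\<^sub>C y)))
      = (SUP \<theta>::real. norm (im_part (exp (\<i> * complex_of_real \<theta>) *\<^sub>C x)) *
                       norm (im_part (exp (\<i> * complex_of_real \<theta>) *\<^sub>C y)))"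
proof -
  obtain s where s: "shifted_product_sup x y s = aligned_product_sup x y"
    using shifted_eq_aligned[OF assms] by blast
  \<comment> \<open>Both factors are rotated by the same \<open>- pi / 2\<close>, which keeps their
    relative shift; hence the \<open>s\<close> found for (i) also serves (ii).\<close>
  have lhs: "(SUP \<theta>. norm (im_part (cis \<theta> *\<^sub>C x) * im_part (cis (\<theta> + s) *\<^sub>C y)))
      = shifted_product_sup x y s"
    unfolding shifted_product_sup_def
    by (subst (2) SUP_shift[where s = "pi / 2", symmetric]) (simp add: im_part_cis diff_add_eq)
  have rhs: "(SUP \<theta>. norm (im_part (cis \<theta> *\<^sub>C x)) * norm (im_part (cis \<theta> *\<^sub>C y)))
      = aligned_product_sup x y"
    unfolding aligned_product_sup_def
    by (subst (2) SUP_shift[where s = "pi / 2", symmetric]) (simp add: im_part_cis)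
  show ?thesis
    unfolding cis_conv_exp[symmetric]
    by (intro exI[of _ s] conjI s[unfolded shifted_product_sup_def aligned_product_sup_def]
        trans[OF lhs trans[OF s rhs[symmetric]]])
qed

end
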